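(* Let $n\ge 1$ and let $P$ be the path with vertices $1,2,\ldots,n+1$ in order, with edges $f_j=\{j,j+1\}$ for $j=1,\ldots,n$, each regarded as the transposition $(j,j+1)$. Consider an ordering $f_{a_1},f_{a_2},\ldots,f_{a_n}$ of the edges (so $[a_1,\ldots,a_n]$ is a permutation of $\{1,\ldots,n\}$), and let $\pi(j)$ denote the position of $f_j$ in this ordering (so $\pi(a_k)=k$). Then the product $f_{a_1}f_{a_2}\cdots f_{a_n}$ equals the cyclic permutation $$(1,3,5,\ldots,6,4,2),$$ which lists the odd elements of $\{1,\ldots,n+1\}$ in increasing order followed by the even elements of $\{1,\ldots,n+1\}$ in decreasing order, if and only if $\pi(1)<\pi(2)>\pi(3)<\pi(4)>\cdots$ (i.e. $\pi$ is an up-down permutation in passive form; equivalently, the ordering is the inverse of an up-down permutation).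
   Context: Permutations act on the right and products are composed left to right: $x(gh)=(xg)h$, so in $f_{a_1}\cdots f_{a_n}$ the transposition $f_{a_1}$ is applied first. A permutation with passive form $[b_1,\ldots,b_n]$ is up-down if $b_1<b_2>b_3<b_4>\cdots$. *)

theory Defs
  imports "HOL-Combinatorics.Cycles"
begin

definition path_edge :: "nat \<Rightarrow> nat \<Rightarrow> nat" where
  "path_edge j = Transposition.transpose j (j + 1)"

text \<open>Permutations act on the right, so the head of the list is applied first:
  \<open>left_to_right_prod [g, h] = h \<circ> g\<close>.\<close>

definition left_to_right_prod :: "('a \<Rightarrow> 'a) list \<Rightarrow> 'a \<Rightarrow> 'a" where
  "left_to_right_prod gs = fold (\<circ>) gs id"

definition odd_even_cycle :: "nat \<Rightarrow> nat \<Rightarrow> nat" where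
  "odd_even_cycle m = cycle_of_list (filter odd [1..<m + 1] @ rev (filter even [1..<m + 1]))"

text \<open>The passive form \<open>[b 1, \<dots>, b n]\<close> satisfies \<open>b 1 < b 2 > b 3 < b 4 > \<dots>\<close>.\<close>

definition up_down :: "nat \<Rightarrow> (nat \<Rightarrow> nat) \<Rightarrow> bool" where
  "up_down n b \<longleftrightarrow> (\<forall>i. 1 \<le> i \<and> i < n \<longrightarrow> (if odd i then b i < b (i + 1) else b i > b (i + 1)))"

end

theory Submission
  imports Defs
begin

text \<open>Follow each vertex through the product. A vertex \<open>x\<close> first moves along whichever of its
  two edges \<open>f (x - 1)\<close>, \<open>f x\<close> comes earlier in the ordering, and it can never cross that edge
  back. Hence the product determines, for every inner vertex, the order of its two edges, which
  is the forward direction. Conversely, for an up-down \<open>\<pi>\<close> the trajectory of every vertex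
  consists of at most two moves in the same direction: odd vertices move right and even ones left,
  except that an odd last vertex moves left.\<close>

section \<open>Values of the cycle (1,3,5,...,6,4,2)\<close>

lemma cycle_of_list_successor:
  assumes "distinct (xs @ x # y # ys)"
  shows "cycle_of_list (xs @ x # y # ys) x = y"
proof -
  let ?cs = "xs @ x # y # ys"
  \<comment> \<open>Applying the cycle to its own list entrywise rotates the list by one; the entry
    at index \<open>length xs\<close> is \<open>x\<close> before and \<open>y\<close> after.\<close>
  have "map (cycle_of_list ?cs) ?cs ! length xs = rotate1 ?cs ! length xs"
    using cyclic_rotation[OF assms, of 1] by simp
  then show ?thesis
    by (simp add: nth_rotate1 nth_append)
qed

lemma cycle_of_list_last:
  assumes "distinct (x # ys @ [y])"
  shows "cycle_of_list (x # ys @ [y]) y = x"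
  using cyclic_rotation[OF assms, of 1] by simp

lemma set_odd_even_list: "set (filter odd [1..<m + 1] @ rev (filter even [1..<m + 1])) = {1..m}"
  by auto

lemma distinct_odd_even_list: "distinct (filter odd [1..<m + 1] @ rev (filter even [1..<m + 1]))"
  by auto

lemma odd_even_cycle_outside:
  assumes "x \<notin> {1..m}"
  shows "odd_even_cycle m x = x"
  unfolding odd_even_cycle_def by (rule id_outside_supp) (use assms set_odd_even_list in blast)

lemma odd_even_cycle_successor:
  assumes "filter odd [1..<m + 1] @ rev (filter even [1..<m + 1]) = xs @ x # y # ys"
  shows "odd_even_cycle m x = y"
  unfolding odd_even_cycle_def
  using cycle_of_list_successor distinct_odd_even_list[of m] unfolding assms by metis

lemma upt_split2:
  assumes "i \<le> j" "j + 1 < k"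
  shows "[i..<k] = [i..<j] @ j # (j + 1) # [j + 2..<k]"
  using assms upt_add_eq_append[of i j "k - j"] by (simp add: upt_conv_Cons)

lemma upt_split3:
  assumes "i \<le> j" "j + 2 < k"
  shows "[i..<k] = [i..<j] @ j # (j + 1) # (j + 2) # [j + 3..<k]"
  using assms upt_add_eq_append[of i j "k - j"] by (simp add: upt_conv_Cons eval_nat_numeral)

text \<open>\<open>x\<close> and \<open>x + 2\<close> become neighbours once the even
  \<open>x + 1\<close> is filtered out.\<close>

lemma odd_even_cycle_odd:
  assumes "odd x" "x + 2 \<le> m"
  shows "odd_even_cycle m x = x + 2"
proof -
  have "1 \<le> x" using assms by (cases x) auto
  then have "[1..<m + 1] = [1..<x] @ x # (x + 1) # (x + 2) # [x + 3..<m + 1]"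
    using assms by (intro upt_split3) auto
  then have "filter odd [1..<m + 1] = filter odd [1..<x] @ x # (x + 2) # filter odd [x + 3..<m + 1]"
    using assms by (simp del: upt_Suc)
  then show ?thesis
    by (intro odd_even_cycle_successor[where xs = "filter odd [1..<x]"
          and ys = "filter odd [x + 3..<m + 1] @ rev (filter even [1..<m + 1])"]) (simp del: upt_Suc)
qed

lemma odd_even_cycle_even:
  assumes "even x" "1 \<le> x" "x + 2 \<le> m"
  shows "odd_even_cycle m (x + 2) = x"
proof -
  have "[1..<m + 1] = [1..<x] @ x # (x + 1) # (x + 2) # [x + 3..<m + 1]"
    using assms by (intro upt_split3) auto
  then have "rev (filter even [1..<m + 1])
      = rev (filter even [x + 3..<m + 1]) @ (x + 2) # x # rev (filter even [1..<x])"
    using assms by (simp del: upt_Suc)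
  then show ?thesis
    by (intro odd_even_cycle_successor
        [where xs = "filter odd [1..<m + 1] @ rev (filter even [x + 3..<m + 1])"
          and ys = "rev (filter even [1..<x])"]) (simp del: upt_Suc)
qed

text \<open>At the junction of the two filtered lists the largest odd entry is followed by the
  largest even one. Which of these is \<open>n\<close> and which is \<open>n + 1\<close> depends on
  the parity of \<open>n\<close>, hence two lemmas.\<close>

lemma odd_even_cycle_turn_even:
  assumes "odd n"
  shows "odd_even_cycle (n + 1) n = n + 1"
proof -
  have "1 \<le> n" using assms by (cases n) auto
  then have "[1..<n + 1 + 1] = [1..<n] @ [n, n + 1]"
    by simp
  then show ?thesis
    using assms by (intro odd_even_cycle_successor) simp
qed

lemma odd_even_cycle_turn_odd:
  assumes "even n" "1 \<le> n"
  shows "odd_even_cycle (n + 1) (n + 1) = n"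
proof -
  have "[1..<n + 1 + 1] = [1..<n] @ [n, n + 1]"
    using assms by simp
  then show ?thesis
    using assms by (intro odd_even_cycle_successor) simp
qed

text \<open>The wrap-around: 2 ends the reversed even part, and 1 opens the list.\<close>

lemma odd_even_cycle_2:
  assumes "2 \<le> m"
  shows "odd_even_cycle m 2 = 1"
proof -
  have "[1..<m + 1] = 1 # 2 # [3..<m + 1]"
    using upt_split2[of 1 1 "m + 1"] assms by (simp del: upt_Suc add: eval_nat_numeral)
  then have "filter odd [1..<m + 1] @ rev (filter even [1..<m + 1])
      = 1 # (filter odd [3..<m + 1] @ rev (filter even [3..<m + 1])) @ [2]"
    by (simp del: upt_Suc)
  then show ?thesis
    unfolding odd_even_cycle_def using cycle_of_list_last distinct_odd_even_list[of m] by metis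
qed

text \<open>The bound \<open>x \<le> n\<close> leaves out the last vertex: for even
  \<open>n \<ge> 2\<close> the odd vertex \<open>n + 1\<close> is sent down to
  \<open>n\<close>.\<close>

lemma odd_even_cycle_greater:
  assumes "odd x" "x \<le> n"
  shows "x < odd_even_cycle (n + 1) x"
  using assms odd_even_cycle_odd[of x "n + 1"] odd_even_cycle_turn_even[of n]
  by (cases "x = n") auto

lemma odd_even_cycle_less:
  assumes "even x" "1 \<le> x" "x \<le> n + 1"
  shows "odd_even_cycle (n + 1) x < x"
proof (cases "x = 2")
  case True
  then show ?thesis using odd_even_cycle_2[of "n + 1"] assms by simp
next
  case False
  then have "x = (x - 2) + 2" "even (x - 2)" "1 \<le> x - 2"
    using assms by (auto elim!: evenE)
  then show ?thesis using odd_even_cycle_even[of "x - 2" "n + 1"] assms by simp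
qed

section \<open>Trajectories of vertices through the partial products\<close>

locale edge_ordering =
  fixes n :: nat and a \<pi> :: "nat \<Rightarrow> nat"
  assumes permutes: "a permutes {1..n}"
    and pos_a: "k \<in> {1..n} \<Longrightarrow> \<pi> (a k) = k"
begin

definition partial_prod :: "nat \<Rightarrow> nat \<Rightarrow> nat" where
  "partial_prod k = left_to_right_prod (map (\<lambda>k. path_edge (a k)) [1..<k + 1])"

lemma partial_prod_0 [simp]: "partial_prod 0 x = x"
  by (simp add: partial_prod_def left_to_right_prod_def)

lemma partial_prod_Suc: "partial_prod (Suc k) x = path_edge (a (Suc k)) (partial_prod k x)"
  by (simp add: partial_prod_def left_to_right_prod_def)

lemma a_in: "k \<in> {1..n} \<Longrightarrow> a k \<in> {1..n}"
  using permutes by (simp only: permutes_in_image)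

lemma pos_eq_inv: "e \<in> {1..n} \<Longrightarrow> \<pi> e = inv a e"
  using permutes pos_a by (metis permutes_in_image permutes_inverses(1) permutes_inv)

lemma a_pos: "e \<in> {1..n} \<Longrightarrow> a (\<pi> e) = e"
  by (simp add: pos_eq_inv permutes_inverses[OF permutes])

lemma pos_in: "e \<in> {1..n} \<Longrightarrow> \<pi> e \<in> {1..n}"
  by (metis pos_eq_inv permutes permutes_inv permutes_in_image)

lemma pos_neq: "e \<in> {1..n} \<Longrightarrow> e' \<in> {1..n} \<Longrightarrow> e \<noteq> e' \<Longrightarrow> \<pi> e \<noteq> \<pi> e'"
  by (metis a_pos)

text \<open>Edge \<open>e\<close> does not occur among the factors number \<open>k + 1, \<dots>, l\<close>; the indices \<open>0\<close> and
  \<open>n + 1\<close>, which are not edges, are always idle, so the end vertices need no separate treatment.\<close>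

definition idle :: "nat \<Rightarrow> nat \<Rightarrow> nat \<Rightarrow> bool" where
  "idle e k l \<longleftrightarrow> (e \<in> {1..n} \<longrightarrow> \<pi> e \<le> k \<or> l < \<pi> e)"

lemma idle_neq:
  assumes "idle e k l" "k < i" "i \<le> l" "l \<le> n"
  shows "a i \<noteq> e"
  using assms a_in[of i] pos_a[of i] by (auto simp: idle_def)

text \<open>Only the edges \<open>y - 1\<close> and \<open>y\<close> meet the vertex
  \<open>y\<close>, so every other factor fixes it.\<close>

lemma stay:
  assumes "partial_prod k x = y" "k \<le> l" "l \<le> n" "idle y k l" "idle (y - 1) k l"
  shows "partial_prod l x = y"
  using assms(2-)
proof (induction l rule: dec_induct)
  case base
  then show ?case using assms(1) by simp
next
  case (step l)
  have "idle y k l" "idle (y - 1) k l"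
    using step.prems by (auto simp: idle_def)
  then have IH: "partial_prod l x = y"
    using step by simp
  have "a (Suc l) \<noteq> y" "a (Suc l) \<noteq> y - 1"
    using step idle_neq[of _ k "Suc l" "Suc l"] by auto
  moreover have "1 \<le> a (Suc l)"
    using a_in[of "Suc l"] step.prems by simp
  ultimately show ?case
    by (auto simp: partial_prod_Suc IH path_edge_def transpose_def)
qed

text \<open>The trajectory waits at \<open>y\<close> through factor \<open>\<pi> y - 1\<close>, as
  neither edge at \<open>y\<close> occurs in between; then factor \<open>\<pi> y\<close>, which is
  edge \<open>y\<close>, carries it across.\<close>

lemma move_right:
  assumes "partial_prod k x = y" "y \<in> {1..n}" "k < \<pi> y" "idle (y - 1) k (\<pi> y)"
  shows "partial_prod (\<pi> y) x = y + 1"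
proof -
  have y: "\<pi> y \<le> n" "Suc (\<pi> y - 1) = \<pi> y"
    using pos_in[OF assms(2)] by auto
  have "partial_prod (\<pi> y - 1) x = y"
    using assms y by (intro stay[OF assms(1)]) (auto simp: idle_def)
  then show ?thesis
    using partial_prod_Suc[of "\<pi> y - 1" x] y a_pos[OF assms(2)] by (simp add: path_edge_def)
qed

lemma move_left:
  assumes "partial_prod k x = y + 1" "y \<in> {1..n}" "k < \<pi> y" "idle (y + 1) k (\<pi> y)"
  shows "partial_prod (\<pi> y) x = y"
proof -
  have y: "\<pi> y \<le> n" "Suc (\<pi> y - 1) = \<pi> y"
    using pos_in[OF assms(2)] by auto
  have "partial_prod (\<pi> y - 1) x = y + 1"
    using assms y by (intro stay[OF assms(1)]) (auto simp: idle_def)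
  then show ?thesis
    using partial_prod_Suc[of "\<pi> y - 1" x] y a_pos[OF assms(2)] by (simp add: path_edge_def)
qed

text \<open>Edge \<open>y\<close> is the only one joining the vertices up to \<open>y\<close> to
  those beyond, so every other factor preserves both sides. The same reason gives
  \<open>stays_left\<close>.\<close>

lemma stays_right:
  assumes "partial_prod k x > y" "k \<le> l" "l \<le> n" "idle y k l"
  shows "partial_prod l x > y"
  using assms(2-)
proof (induction l rule: dec_induct)
  case base
  then show ?case using assms(1) by simp
next
  case (step l)
  have "idle y k l"
    using step.prems by (auto simp: idle_def)
  then have "partial_prod l x > y"
    using step by simp
  moreover have "a (Suc l) \<noteq> y"
    using step idle_neq[of _ k "Suc l" "Suc l"] by auto
  ultimately show ?case
    by (auto simp: partial_prod_Suc path_edge_def transpose_def)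
qed

lemma stays_left:
  assumes "partial_prod k x \<le> y" "k \<le> l" "l \<le> n" "idle y k l"
  shows "partial_prod l x \<le> y"
  using assms(2-)
proof (induction l rule: dec_induct)
  case base
  then show ?case using assms(1) by simp
next
  case (step l)
  have "idle y k l"
    using step.prems by (auto simp: idle_def)
  then have "partial_prod l x \<le> y"
    using step by simp
  moreover have "a (Suc l) \<noteq> y"
    using step idle_neq[of _ k "Suc l" "Suc l"] by auto
  ultimately show ?case
    by (auto simp: partial_prod_Suc path_edge_def transpose_def)
qed

section \<open>Forward direction: the product determines the order of adjacent edges\<close>

lemma prod_greater:
  assumes "1 \<le> i" "i < n" "\<pi> (i + 1) < \<pi> i"
  shows "i + 1 < partial_prod n (i + 1)"
proof -
  have p: "\<pi> (i + 1) \<in> {1..n}" using pos_in assms by simp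
  have "partial_prod (\<pi> (i + 1)) (i + 1) = i + 1 + 1"
    using assms p by - (rule move_right[of 0], auto simp: idle_def)
  \<comment> \<open>Edge \<open>i + 1\<close> has now been used up, so the trajectory cannot return
    across it.\<close>
  then show ?thesis
    using assms p by - (rule stays_right[of "i + 1" "\<pi> (i + 1)"], auto simp: idle_def)
qed

lemma prod_less:
  assumes "1 \<le> i" "i < n" "\<pi> i < \<pi> (i + 1)"
  shows "partial_prod n (i + 1) < i + 1"
proof -
  have p: "\<pi> i \<in> {1..n}" using pos_in assms by simp
  have "partial_prod (\<pi> i) (i + 1) = i"
    using assms p by - (rule move_left[of 0], auto simp: idle_def)
  then have "partial_prod n (i + 1) \<le> i"
    using assms p by - (rule stays_left[of "\<pi> i"], auto simp: idle_def)
  then show ?thesis by simp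
qed

lemma up_down_if_prod_eq:
  assumes "partial_prod n = odd_even_cycle (n + 1)"
  shows "up_down n \<pi>"
  unfolding up_down_def
proof (intro allI impI)
  fix i assume i: "1 \<le> i \<and> i < n"
  have neq: "\<pi> i \<noteq> \<pi> (i + 1)"
    using pos_neq i by simp
  show "if odd i then \<pi> i < \<pi> (i + 1) else \<pi> (i + 1) < \<pi> i"
  proof (cases "odd i")
    case True
    \<comment> \<open>The cycle lowers the even vertex \<open>i + 1\<close>, whereas the wrong order
      of its two edges would raise it.\<close>
    then have "partial_prod n (i + 1) < i + 1"
      using odd_even_cycle_less[of "i + 1" n] i assms by simp
    then have "\<not> \<pi> (i + 1) < \<pi> i"
      using prod_greater[of i] i by auto
    then show ?thesis using True neq by simp
  next
    case False
    then have "i + 1 < partial_prod n (i + 1)"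
      using odd_even_cycle_greater[of "i + 1" n] i assms by simp
    then have "\<not> \<pi> i < \<pi> (i + 1)"
      using prod_less[of i] i by auto
    then show ?thesis using False neq by simp
  qed
qed

section \<open>Converse: trajectories for an up-down \<open>\<pi>\<close>\<close>

lemma up_down_oddD: "up_down n \<pi> \<Longrightarrow> odd i \<Longrightarrow> 1 \<le> i \<Longrightarrow> i < n \<Longrightarrow> \<pi> i < \<pi> (i + 1)"
  by (auto simp: up_down_def)

lemma up_down_evenD: "up_down n \<pi> \<Longrightarrow> even i \<Longrightarrow> 1 \<le> i \<Longrightarrow> i < n \<Longrightarrow> \<pi> (i + 1) < \<pi> i"
  by (auto simp: up_down_def)

text \<open>An odd edge precedes both neighbouring edges, so each of its two endpoints makes its
  first move along it.\<close>

lemma up_down_first_move_right: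
  assumes "up_down n \<pi>" "odd x" "x \<le> n"
  shows "partial_prod (\<pi> x) x = x + 1"
proof -
  have x: "1 \<le> x" using assms by (cases x) auto
  have "idle (x - 1) 0 (\<pi> x)"
    using up_down_evenD[of "x - 1"] assms x by (auto simp: idle_def)
  then show ?thesis
    using pos_in[of x] assms x by - (rule move_right[of 0], auto)
qed

lemma up_down_first_move_left:
  assumes "up_down n \<pi>" "odd x" "x \<le> n"
  shows "partial_prod (\<pi> x) (x + 1) = x"
proof -
  have x: "1 \<le> x" using assms by (cases x) auto
  have "idle (x + 1) 0 (\<pi> x)"
    using up_down_oddD[of x] assms x by (auto simp: idle_def)
  then show ?thesis
    using pos_in[of x] assms x by - (rule move_left[of 0], auto)
qed

text \<open>After edge \<open>x\<close>, the later edge \<open>x + 1\<close> moves the vertex once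
  more. Edge \<open>x + 2\<close>, if there is one, has already been passed in the ordering, so the
  motion ends at \<open>x + 2\<close>.\<close>

lemma up_down_prod_odd:
  assumes "up_down n \<pi>" "odd x" "x + 1 \<le> n"
  shows "partial_prod n x = x + 2"
proof -
  have x: "1 \<le> x" using assms by (cases x) auto
  have less: "\<pi> x < \<pi> (x + 1)"
    using up_down_oddD assms x by simp
  have "partial_prod (\<pi> (x + 1)) x = x + 1 + 1"
    using up_down_first_move_right[of x] assms x less
    by - (rule move_right[of "\<pi> x"], auto simp: idle_def)
  moreover have "idle (x + 2) (\<pi> (x + 1)) n"
    using up_down_evenD[of "x + 1"] assms by (auto simp: idle_def)
  ultimately show ?thesis
    using pos_in[of "x + 1"] assms x by - (rule stay[of "\<pi> (x + 1)"], auto simp: idle_def)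
qed

text \<open>Mirror image: the vertex crosses edge \<open>x + 1\<close>, then edge \<open>x\<close>,
  and stops because the odd edge \<open>x - 1\<close> came before edge \<open>x\<close>.\<close>

lemma up_down_prod_even:
  assumes "up_down n \<pi>" "even x" "1 \<le> x" "x + 1 \<le> n"
  shows "partial_prod n (x + 2) = x"
proof -
  have less: "\<pi> (x + 1) < \<pi> x"
    using up_down_evenD assms by simp
  have "partial_prod (\<pi> x) (x + 2) = x"
    using up_down_first_move_left[of "x + 1"] assms less
    by - (rule move_left[of "\<pi> (x + 1)"], auto simp: idle_def)
  moreover have "idle (x - 1) (\<pi> x) n"
    using up_down_oddD[of "x - 1"] assms by (fastforce simp: idle_def)
  ultimately show ?thesis
    using pos_in[of x] assms by - (rule stay[of "\<pi> x"], auto simp: idle_def)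
qed

lemma up_down_prod_turn_even:
  assumes "up_down n \<pi>" "odd n"
  shows "partial_prod n n = n + 1"
proof -
  have "1 \<le> n" using assms by (cases n) auto
  then show ?thesis
    using up_down_first_move_right[of n] assms pos_in[of n]
    by - (rule stay[of "\<pi> n"], auto simp: idle_def)
qed

text \<open>The exceptional odd vertex: \<open>n + 1\<close> has only edge \<open>n\<close> to use,
  and edge \<open>n - 1\<close> came earlier, so it moves left just once.\<close>

lemma up_down_prod_turn_odd:
  assumes "up_down n \<pi>" "even n" "1 \<le> n"
  shows "partial_prod n (n + 1) = n"
proof -
  have "partial_prod (\<pi> n) (n + 1) = n"
    using assms pos_in[of n] by - (rule move_left[of 0], auto simp: idle_def)
  moreover have "idle (n - 1) (\<pi> n) n"
    using up_down_oddD[of "n - 1"] assms by (auto simp: idle_def)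
  ultimately show ?thesis
    using assms pos_in[of n] by - (rule stay[of "\<pi> n"], auto simp: idle_def)
qed

lemma up_down_prod_2:
  assumes "up_down n \<pi>" "1 \<le> n"
  shows "partial_prod n 2 = 1"
proof -
  have "partial_prod (\<pi> 1) 2 = 1"
    using up_down_first_move_left[of 1] assms by (simp add: numeral_2_eq_2)
  then show ?thesis
    using assms pos_in[of 1] by - (rule stay[of "\<pi> 1"], auto simp: idle_def)
qed

lemma prod_eq_if_up_down:
  assumes "up_down n \<pi>" "1 \<le> n"
  shows "partial_prod n = odd_even_cycle (n + 1)"
proof
  fix x
  \<comment> \<open>The cases follow the list of the cycle: two steps up, the turn for odd and for
    even \<open>n\<close>, the wrap-around at 2, and two steps down. In the last case
    \<open>y\<close> names the image, so no subtraction appears.\<close>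
  consider "x \<notin> {1..n + 1}" | "odd x" "x + 1 \<le> n" | "odd x" "x = n" | "odd x" "x = n + 1"
    | "x = 2" "x \<le> n + 1" | y where "x = y + 2" "even y" "1 \<le> y" "y + 1 \<le> n"
  proof (cases "even x \<and> x \<in> {1..n + 1} \<and> x \<noteq> 2")
    case True
    then have "x = (x - 2) + 2" "even (x - 2)" "1 \<le> x - 2" "x - 2 + 1 \<le> n"
      by (auto elim!: evenE)
    then show ?thesis using that(6) by blast
  next
    case False
    then consider "x \<notin> {1..n + 1}" | "x = 2" "x \<le> n + 1" | "odd x" "x \<le> n + 1"
      by fastforce
    then show ?thesis
    proof cases
      case 3
      then consider "x + 1 \<le> n" | "x = n" | "x = n + 1" by linarith
      then show ?thesis using 3 that(2,3,4) by cases blast+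
    qed (use that(1,5) in blast)+
  qed
  then show "partial_prod n x = odd_even_cycle (n + 1) x"
  proof cases
    case 1
    then have "partial_prod n x = x"
      \<comment> \<open>Both indices \<open>x - 1\<close> and \<open>x\<close> are non-edges: they
        are 0 by truncation if \<open>x = 0\<close>, and otherwise exceed \<open>n\<close>.\<close>
      by - (rule stay[of 0], auto simp: idle_def)
    then show ?thesis using odd_even_cycle_outside[of x "n + 1"] 1 by simp
  next
    case 2
    then show ?thesis using up_down_prod_odd odd_even_cycle_odd assms by simp
  next
    case 3
    then show ?thesis using up_down_prod_turn_even odd_even_cycle_turn_even assms by simp
  next
    case 4
    then show ?thesis using up_down_prod_turn_odd odd_even_cycle_turn_odd assms by simp
  next
    case 5
    then show ?thesis using up_down_prod_2 odd_even_cycle_2 assms by simp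
  next
    case 6
    then show ?thesis using up_down_prod_even odd_even_cycle_even assms by simp
  qed
qed

end

section \<open>The equivalence and its formulation by inverses\<close>

lemma up_down_cong:
  assumes "\<And>i. i \<in> {1..n} \<Longrightarrow> b i = c i"
  shows "up_down n b \<longleftrightarrow> up_down n c"
  using assms by (auto simp: up_down_def)

theorem theorem3p5:
  fixes n :: nat and a \<pi> :: "nat \<Rightarrow> nat"
  assumes "n \<ge> 1"
    and "a permutes {1..n}"
    and "\<And>k. k \<in> {1..n} \<Longrightarrow> \<pi> (a k) = k"
  shows "(left_to_right_prod (map (\<lambda>k. path_edge (a k)) [1..<n + 1]) = odd_even_cycle (n + 1)
            \<longleftrightarrow> up_down n \<pi>)
       \<and> (up_down n \<pi> \<longleftrightarrow> (\<exists>\<sigma>. \<sigma> permutes {1..n} \<and> up_down n \<sigma> \<and> a = inv \<sigma>))"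
proof -
  interpret edge_ordering n a \<pi>
    using assms by unfold_locales
  have "partial_prod n = odd_even_cycle (n + 1) \<longleftrightarrow> up_down n \<pi>"
    using up_down_if_prod_eq prod_eq_if_up_down assms(1) by blast
  \<comment> \<open>The values of \<open>\<pi>\<close> outside \<open>{1..n}\<close> are arbitrary,
    so \<open>\<pi>\<close> and \<open>inv a\<close> need not be equal; they agree wherever
    \<open>up_down n\<close> looks.\<close>
  moreover have "up_down n \<pi> \<longleftrightarrow> up_down n (inv a)"
    by (rule up_down_cong) (rule pos_eq_inv)
  \<comment> \<open>The equation \<open>a = inv \<sigma>\<close> forces
    \<open>\<sigma> = inv a\<close>, which is also the witness.\<close>
  moreover have "(\<exists>\<sigma>. \<sigma> permutes {1..n} \<and> up_down n \<sigma> \<and> a = inv \<sigma>) \<longleftrightarrow> up_down n (inv a)"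
  proof
    assume "\<exists>\<sigma>. \<sigma> permutes {1..n} \<and> up_down n \<sigma> \<and> a = inv \<sigma>"
    then show "up_down n (inv a)" by (auto simp: permutes_inv_inv)
  next
    assume "up_down n (inv a)"
    then show "\<exists>\<sigma>. \<sigma> permutes {1..n} \<and> up_down n \<sigma> \<and> a = inv \<sigma>"
      using permutes_inv[OF assms(2)] permutes_inv_inv[OF assms(2)] by metis
  qed
  ultimately show ?thesis
    unfolding partial_prod_def by blast
qed

end
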